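(* Let $(\Gamma,\alpha,\theta,\lambda)$ be a $d$-valent reducible 1-skeleton in $\mathbb{R}^n$. Then $(\Gamma,\alpha,\theta,\lambda)$ has a total lift if and only if $(\dagger)$: every $2$-face of $(\Gamma,\alpha,\theta,\lambda)$ is level and has trivial normal holonomy.
   Context: Graphs. All graphs are finite, simple, connected and regular. For a $d$-valent graph $\Gamma$ with vertex set $V_\Gamma$, $E_\Gamma$ denotes the set of oriented edges (ordered pairs $pq$ of adjacent vertices; every edge occurs with both orientations). For $e=pq$ write $i(e)=p$, $t(e)=q$, $\bar e=qp$; $E^p$ is the set of oriented edges with initial vertex $p$, so $|E^p|=d$. A path $p_0\to p_1\to\cdots\to p_j$ is a sequence of vertices with consecutive ones adjacent; a loop is a path with $p_j=p_0$. Generalized 1-skeleta. A connection $\theta$ on $\Gamma$ is a family of bijections $\theta_e:E^{i(e)}\to E^{t(e)}$ ($e\in E_\Gamma$) with $\theta_e(e)=\bar e$ and $\theta_{\bar e}\circ\theta_e=\mathrm{id}$. A compatibility system for $(\Gamma,\theta)$ is a family of maps $\lambda_e:E^{i(e)}\to\mathbb{R}_{>0}$ with $\lambda_{\bar e}(\theta_e(e'))=1/\lambda_e(e')$. A generalized axial function for $(\Gamma,\theta,\lambda)$ is a map $\alpha:E_\Gamma\to\mathbb{R}^n$ such that (gA1) for each $e$ there is $m_e>0$ with $\alpha(e)=-m_e\alpha(\bar e)$, and (gA2) for each $e\in E_\Gamma$ and $e'\in E^{i(e)}\setminus\{e\}$, $\alpha(e')-\lambda_e(e')\alpha(\theta_e(e'))\in\mathbb{R}\alpha(e)$.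 Then $(\Gamma,\alpha,\theta,\lambda)$ is a ($d$-valent) generalized 1-skeleton in $\mathbb{R}^n$. It is a 1-skeleton if moreover $\alpha(\bar e)=-\alpha(e)$ for all $e$ and, for each vertex $p$, the vectors $\alpha(e)$, $e\in E^p$, are pairwise linearly independent. $\alpha$ is effective if for every $p$ the vectors $\alpha(e)$, $e\in E^p$, span $\mathbb{R}^n$. Subskeleta. A ($k$-valent) subskeleton is given by a connected $k$-regular subgraph $\Gamma_0=(V_0,E_0)$ that is totally geodesic: $\theta_e(E^{i(e)}\cap E_0)\subseteq E^{t(e)}\cap E_0$ for all $e\in E_0$ (with $\alpha,\theta,\lambda$ restricted). For $p\in V_0$, the normal edges at $p$ are $N_0^p=E^p\setminus E_0$. For a path $\gamma:p_0\to\cdots\to p_j$ in $\Gamma_0$, the normal path-connection map is $K^\perp_\gamma=\theta_{p_{j-1}p_j}\circ\cdots\circ\theta_{p_0p_1}:N_0^{p_0}\to N_0^{p_j}$, and for $e\in E^{p_0}$ the local path-connection number is $|K_\gamma(e)|=\prod_{i=1}^{j}\lambda_{p_{i-1}p_i}\big(\theta_{p_{i-2}p_{i-1}}\circ\cdots\circ\theta_{p_0p_1}(e)\big)$ (the $i=1$ factor being $\lambda_{p_0p_1}(e)$). The subskeleton has trivial normal holonomy if $K^\perp_\gamma$ is the identity for every loop $\gamma$ in $\Gamma_0$; it is level if for every $p\in V_0$, $e\in N_0^p$ and every loop $\gamma$ in $\Gamma_0$ based at $p$ with $K^\perp_\gamma(e)=e$ one has $|K_\gamma(e)|=1$. Polarizations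 and faces. A covector $\xi\in(\mathbb{R}^n)^*$ is generic if $\langle\xi,\alpha(e)\rangle\neq0$ for all $e$; it orients $\Gamma$ by declaring $e$ directed when $\langle\xi,\alpha(e)\rangle>0$, and it is polarizing if this orientation has no directed loop. A $k$-face (with respect to a polarizing $\xi$) is a $k$-valent subskeleton having exactly one vertex $p$ with $\langle\xi,\alpha(e)\rangle>0$ for all $e\in E^p\cap E_0$. The generalized 1-skeleton has enough $2$-faces if for every vertex $p$ and any two distinct $e_1,e_2\in E^p$ there is a unique $2$-face containing $e_1$ and $e_2$. A 1-skeleton is reducible if it admits a polarizing covector with respect to which it has enough $2$-faces (the $2$-faces referred to are those for such a covector). Total lift. A $d$-valent generalized 1-skeleton $(\Gamma,\alpha,\theta,\lambda)$ in a real vector space $W$ has a total lift if there exist an effective generalized axial function $A:E_\Gamma\to\mathbb{R}^d$ for the same $(\Gamma,\theta,\lambda)$ and a surjective linear map $p:\mathbb{R}^d\to W$ with $\alpha=p\circ A$.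
   Formalization: The formal theorem additionally assumes that α is effective (the α(e), e∈E^p, span ℝ^n at every p); without this the claim fails, e.g. for a triangle in ℝ² regarded inside ℝ³, since no linear map ℝ²→ℝ³ is onto. It also takes n, d ≥ 1. *)

theory Defs
  imports
    "HOL-Analysis.Analysis"
    "Graph_Theory.Digraph_Component"
    "Graph_Theory.Vertex_Walk"
begin

text \<open>
  An oriented edge \<open>pq\<close> is the pair \<open>(p, q)\<close>, so \<open>i(e)\<close>, \<open>t(e)\<close> and the reversal of \<open>e\<close> are \<^term>\<open>fst e\<close>,
  \<^term>\<open>snd e\<close> and \<^term>\<open>prod.swap e\<close>, and \<open>E\<^sup>p\<close> is \<^term>\<open>out_arcs (with_proj G) p\<close>.
  Connections and compatibility systems are total functions whose values matter only
  on the edges of the graph with the right initial vertex.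
\<close>

definition regular_graph :: "nat \<Rightarrow> 'v pair_pre_digraph \<Rightarrow> bool" where
  "regular_graph k G \<longleftrightarrow>
     pair_graph G \<and> Digraph_Component.connected (with_proj G) \<and>
     (\<forall>p\<in>pverts G. out_degree (with_proj G) p = k)"

definition connection ::
  "'v pair_pre_digraph \<Rightarrow> ('v \<times> 'v \<Rightarrow> 'v \<times> 'v \<Rightarrow> 'v \<times> 'v) \<Rightarrow> bool" where
  "connection G \<theta> \<longleftrightarrow>
     (\<forall>e\<in>parcs G.
        bij_betw (\<theta> e) (out_arcs (with_proj G) (fst e)) (out_arcs (with_proj G) (snd e)) \<and>
        \<theta> e e = prod.swap e \<and>
        (\<forall>e'\<in>out_arcs (with_proj G) (fst e). \<theta> (prod.swap e) (\<theta> e e') = e'))"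

definition compatibility_system ::
  "'v pair_pre_digraph \<Rightarrow> ('v \<times> 'v \<Rightarrow> 'v \<times> 'v \<Rightarrow> 'v \<times> 'v) \<Rightarrow>
   ('v \<times> 'v \<Rightarrow> 'v \<times> 'v \<Rightarrow> real) \<Rightarrow> bool" where
  "compatibility_system G \<theta> l \<longleftrightarrow>
     (\<forall>e\<in>parcs G. \<forall>e'\<in>out_arcs (with_proj G) (fst e).
        l e e' > 0 \<and> l (prod.swap e) (\<theta> e e') = 1 / l e e')"

definition generalized_axial_function ::
  "'v pair_pre_digraph \<Rightarrow> ('v \<times> 'v \<Rightarrow> 'v \<times> 'v \<Rightarrow> 'v \<times> 'v) \<Rightarrow>
   ('v \<times> 'v \<Rightarrow> 'v \<times> 'v \<Rightarrow> real) \<Rightarrow> ('v \<times> 'v \<Rightarrow> real ^ 'n) \<Rightarrow> bool" where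
  "generalized_axial_function G \<theta> l \<alpha> \<longleftrightarrow>
     (\<forall>e\<in>parcs G. \<exists>m>0. \<alpha> e = - (m *\<^sub>R \<alpha> (prod.swap e))) \<and>
     (\<forall>e\<in>parcs G. \<forall>e'\<in>out_arcs (with_proj G) (fst e) - {e}.
        \<exists>c. \<alpha> e' - l e e' *\<^sub>R \<alpha> (\<theta> e e') = c *\<^sub>R \<alpha> e)"

definition generalized_one_skeleton ::
  "nat \<Rightarrow> 'v pair_pre_digraph \<Rightarrow> ('v \<times> 'v \<Rightarrow> real ^ 'n) \<Rightarrow>
   ('v \<times> 'v \<Rightarrow> 'v \<times> 'v \<Rightarrow> 'v \<times> 'v) \<Rightarrow> ('v \<times> 'v \<Rightarrow> 'v \<times> 'v \<Rightarrow> real) \<Rightarrow> bool" where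
  "generalized_one_skeleton d G \<alpha> \<theta> l \<longleftrightarrow>
     regular_graph d G \<and> connection G \<theta> \<and> compatibility_system G \<theta> l \<and>
     generalized_axial_function G \<theta> l \<alpha>"

text \<open>
  The conjunct \<open>\<alpha> e \<noteq> \<alpha> e'\<close> is needed because \<^const>\<open>independent\<close> is a property of sets.
\<close>

definition one_skeleton ::
  "nat \<Rightarrow> 'v pair_pre_digraph \<Rightarrow> ('v \<times> 'v \<Rightarrow> real ^ 'n) \<Rightarrow>
   ('v \<times> 'v \<Rightarrow> 'v \<times> 'v \<Rightarrow> 'v \<times> 'v) \<Rightarrow> ('v \<times> 'v \<Rightarrow> 'v \<times> 'v \<Rightarrow> real) \<Rightarrow> bool" where
  "one_skeleton d G \<alpha> \<theta> l \<longleftrightarrow>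
     generalized_one_skeleton d G \<alpha> \<theta> l \<and>
     (\<forall>e\<in>parcs G. \<alpha> (prod.swap e) = - \<alpha> e) \<and>
     (\<forall>p\<in>pverts G. \<forall>e\<in>out_arcs (with_proj G) p. \<forall>e'\<in>out_arcs (with_proj G) p.
        e \<noteq> e' \<longrightarrow> \<alpha> e \<noteq> \<alpha> e' \<and> independent {\<alpha> e, \<alpha> e'})"

definition effective :: "'v pair_pre_digraph \<Rightarrow> ('v \<times> 'v \<Rightarrow> real ^ 'n) \<Rightarrow> bool" where
  "effective G \<alpha> \<longleftrightarrow> (\<forall>p\<in>pverts G. span (\<alpha> ` out_arcs (with_proj G) p) = UNIV)"

definition subskeleton ::
  "nat \<Rightarrow> 'v pair_pre_digraph \<Rightarrow> ('v \<times> 'v \<Rightarrow> 'v \<times> 'v \<Rightarrow> 'v \<times> 'v) \<Rightarrow>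
   'v pair_pre_digraph \<Rightarrow> bool" where
  "subskeleton k G \<theta> H \<longleftrightarrow>
     subgraph (with_proj H) (with_proj G) \<and> regular_graph k H \<and>
     (\<forall>e\<in>parcs H. \<theta> e ` (out_arcs (with_proj G) (fst e) \<inter> parcs H)
        \<subseteq> out_arcs (with_proj G) (snd e) \<inter> parcs H)"

definition normal_edges ::
  "'v pair_pre_digraph \<Rightarrow> 'v pair_pre_digraph \<Rightarrow> 'v \<Rightarrow> ('v \<times> 'v) set" where
  "normal_edges G H p = out_arcs (with_proj G) p - parcs H"

text \<open>
  A path is a nonempty list of vertices \<open>[p\<^sub>0, \<dots>, p\<^sub>j]\<close>, i.e. a \<^const>\<open>vwalk\<close>.
\<close>

definition loop_in :: "'v pair_pre_digraph \<Rightarrow> 'v \<Rightarrow> 'v list \<Rightarrow> bool" where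
  "loop_in H p \<gamma> \<longleftrightarrow> vwalk \<gamma> (with_proj H) \<and> hd \<gamma> = p \<and> last \<gamma> = p"

definition path_connection ::
  "('v \<times> 'v \<Rightarrow> 'v \<times> 'v \<Rightarrow> 'v \<times> 'v) \<Rightarrow> 'v list \<Rightarrow> 'v \<times> 'v \<Rightarrow> 'v \<times> 'v" where
  "path_connection \<theta> \<gamma> = fold \<theta> (vwalk_arcs \<gamma>)"

definition path_connection_number ::
  "('v \<times> 'v \<Rightarrow> 'v \<times> 'v \<Rightarrow> 'v \<times> 'v) \<Rightarrow> ('v \<times> 'v \<Rightarrow> 'v \<times> 'v \<Rightarrow> real) \<Rightarrow>
   'v list \<Rightarrow> 'v \<times> 'v \<Rightarrow> real" where
  "path_connection_number \<theta> l \<gamma> e =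
     (\<Prod>i = 1..<length \<gamma>. l (\<gamma> ! (i - 1), \<gamma> ! i) (path_connection \<theta> (take i \<gamma>) e))"

definition trivial_normal_holonomy ::
  "'v pair_pre_digraph \<Rightarrow> ('v \<times> 'v \<Rightarrow> 'v \<times> 'v \<Rightarrow> 'v \<times> 'v) \<Rightarrow>
   'v pair_pre_digraph \<Rightarrow> bool" where
  "trivial_normal_holonomy G \<theta> H \<longleftrightarrow>
     (\<forall>p \<gamma>. loop_in H p \<gamma> \<longrightarrow> (\<forall>e\<in>normal_edges G H p. path_connection \<theta> \<gamma> e = e))"

definition level ::
  "'v pair_pre_digraph \<Rightarrow> ('v \<times> 'v \<Rightarrow> 'v \<times> 'v \<Rightarrow> 'v \<times> 'v) \<Rightarrow>
   ('v \<times> 'v \<Rightarrow> 'v \<times> 'v \<Rightarrow> real) \<Rightarrow> 'v pair_pre_digraph \<Rightarrow> bool" where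
  "level G \<theta> l H \<longleftrightarrow>
     (\<forall>p\<in>pverts H. \<forall>e\<in>normal_edges G H p. \<forall>\<gamma>.
        loop_in H p \<gamma> \<and> path_connection \<theta> \<gamma> e = e \<longrightarrow> path_connection_number \<theta> l \<gamma> e = 1)"

definition generic_covector ::
  "'v pair_pre_digraph \<Rightarrow> ('v \<times> 'v \<Rightarrow> real ^ 'n) \<Rightarrow> (real ^ 'n \<Rightarrow> real) \<Rightarrow> bool" where
  "generic_covector G \<alpha> \<xi> \<longleftrightarrow> linear \<xi> \<and> (\<forall>e\<in>parcs G. \<xi> (\<alpha> e) \<noteq> 0)"

definition polarizing ::
  "'v pair_pre_digraph \<Rightarrow> ('v \<times> 'v \<Rightarrow> real ^ 'n) \<Rightarrow> (real ^ 'n \<Rightarrow> real) \<Rightarrow> bool" where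
  "polarizing G \<alpha> \<xi> \<longleftrightarrow> generic_covector G \<alpha> \<xi> \<and> acyclic {e \<in> parcs G. \<xi> (\<alpha> e) > 0}"

definition face ::
  "nat \<Rightarrow> 'v pair_pre_digraph \<Rightarrow> ('v \<times> 'v \<Rightarrow> real ^ 'n) \<Rightarrow>
   ('v \<times> 'v \<Rightarrow> 'v \<times> 'v \<Rightarrow> 'v \<times> 'v) \<Rightarrow> (real ^ 'n \<Rightarrow> real) \<Rightarrow> 'v pair_pre_digraph \<Rightarrow> bool" where
  "face k G \<alpha> \<theta> \<xi> H \<longleftrightarrow>
     subskeleton k G \<theta> H \<and>
     (\<exists>!p. p \<in> pverts H \<and> (\<forall>e\<in>out_arcs (with_proj G) p \<inter> parcs H. \<xi> (\<alpha> e) > 0))"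

definition enough_two_faces ::
  "'v pair_pre_digraph \<Rightarrow> ('v \<times> 'v \<Rightarrow> real ^ 'n) \<Rightarrow>
   ('v \<times> 'v \<Rightarrow> 'v \<times> 'v \<Rightarrow> 'v \<times> 'v) \<Rightarrow> (real ^ 'n \<Rightarrow> real) \<Rightarrow> bool" where
  "enough_two_faces G \<alpha> \<theta> \<xi> \<longleftrightarrow>
     (\<forall>p\<in>pverts G. \<forall>e\<^sub>1\<in>out_arcs (with_proj G) p. \<forall>e\<^sub>2\<in>out_arcs (with_proj G) p.
        e\<^sub>1 \<noteq> e\<^sub>2 \<longrightarrow> (\<exists>!H. face 2 G \<alpha> \<theta> \<xi> H \<and> e\<^sub>1 \<in> parcs H \<and> e\<^sub>2 \<in> parcs H))"

text \<open>
  Faces depend on the covector, so reducibility is recorded together with the covector that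
  witnesses it; the underlying property is its existential closure.
\<close>

definition reducible_wrt ::
  "'v pair_pre_digraph \<Rightarrow> ('v \<times> 'v \<Rightarrow> real ^ 'n) \<Rightarrow>
   ('v \<times> 'v \<Rightarrow> 'v \<times> 'v \<Rightarrow> 'v \<times> 'v) \<Rightarrow> (real ^ 'n \<Rightarrow> real) \<Rightarrow> bool" where
  "reducible_wrt G \<alpha> \<theta> \<xi> \<longleftrightarrow> polarizing G \<alpha> \<xi> \<and> enough_two_faces G \<alpha> \<theta> \<xi>"

text \<open>
  The type argument \<open>'d\<close> supplies \<open>\<real>\<^sup>d\<close>; the definition is meant for \<open>d\<close>-valent skeleta with
  \<open>d = CARD('d)\<close>.
\<close>

definition has_total_lift ::
  "'d::finite itself \<Rightarrow> 'v pair_pre_digraph \<Rightarrow> ('v \<times> 'v \<Rightarrow> real ^ 'n) \<Rightarrow>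
   ('v \<times> 'v \<Rightarrow> 'v \<times> 'v \<Rightarrow> 'v \<times> 'v) \<Rightarrow> ('v \<times> 'v \<Rightarrow> 'v \<times> 'v \<Rightarrow> real) \<Rightarrow> bool" where
  "has_total_lift _ G \<alpha> \<theta> l \<longleftrightarrow>
     (\<exists>(A :: 'v \<times> 'v \<Rightarrow> real ^ 'd) (P :: real ^ 'd \<Rightarrow> real ^ 'n).
        generalized_axial_function G \<theta> l A \<and> effective G A \<and>
        linear P \<and> surj P \<and> (\<forall>e\<in>parcs G. \<alpha> e = P (A e)))"

text \<open>
  A total lift forces \<open>\<alpha>\<close> to be effective: without effectiveness a total lift in
  \<open>\<real>\<^sup>n\<close> cannot exist, whatever the 2-faces look like.
\<close>

lemma has_total_lift_imp_effective:
  fixes \<alpha> :: "'v \<times> 'v \<Rightarrow> real ^ 'n"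
  assumes "has_total_lift TYPE('d::finite) G \<alpha> \<theta> l"
  shows "effective G \<alpha>"
proof -
  obtain A :: "'v \<times> 'v \<Rightarrow> real ^ 'd" and P :: "real ^ 'd \<Rightarrow> real ^ 'n"
    where A: "effective G A" and P: "linear P" "surj P"
      and eq: "\<forall>e\<in>parcs G. \<alpha> e = P (A e)"
    using assms unfolding has_total_lift_def by blast
  have "span (\<alpha> ` out_arcs (with_proj G) p) = UNIV" if "p \<in> pverts G" for p
  proof -
    have "\<alpha> ` out_arcs (with_proj G) p = P ` A ` out_arcs (with_proj G) p"
      using eq by (force simp: image_image intro!: image_cong)
    then have "span (\<alpha> ` out_arcs (with_proj G) p) = P ` span (A ` out_arcs (with_proj G) p)"
      using P(1) by (simp add: linear_span_image)
    then show ?thesis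
      using A P(2) that by (simp add: effective_def)
  qed
  then show ?thesis
    by (simp add: effective_def)
qed

end

theory Submission
  imports Defs
begin

text \<open>
  A total lift must have the same compatibility coefficients \<open>c\<^sub>e(f)\<close> as \<open>\<alpha>\<close>, so it is a family of
  bases of \<open>\<real>\<^sup>d\<close>, indexed by the vertices, that is parallel for the transport
  \<open>f \<mapsto> \<lambda>\<^sub>e(f) \<theta>\<^sub>e(f) + c\<^sub>e(f) e\<close>. Along a walk in a 2-face this transport is, modulo the plane of
  the face, the path-connection map scaled by the path-connection numbers. Hence a parallel family
  of bases forces the holonomy and the numbers of normal edges to be trivial. Conversely, if these
  are trivial, then transport around a loop of a 2-face is the identity up to an error in the plane
  of the face, and the error vanishes because \<open>\<alpha>\<close> is parallel and injective on that plane. A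
  parallel family is then built vertex by vertex in an order compatible with the polarization: the
  values transported from two lower neighbours agree, since both neighbours descend to the unique
  minimum of their common 2-face.
\<close>

section \<open>Axial functions and path-connection numbers along walks\<close>

lemma generalized_axial_functionD:
  assumes "generalized_axial_function G \<theta> l \<alpha>"
    and "e \<in> parcs G" "f \<in> out_arcs (with_proj G) (fst e)" "f \<noteq> e"
  shows "\<exists>c. \<alpha> f - l e f *\<^sub>R \<alpha> (\<theta> e f) = c *\<^sub>R \<alpha> e"
  using assms unfolding generalized_axial_function_def by (metis DiffI singletonD)

lemma path_connection_Cons_Cons:
  "path_connection \<theta> (x # y # ys) e = path_connection \<theta> (y # ys) (\<theta> (x, y) e)"
  by (simp add: path_connection_def)

lemma path_connection_number_singleton: "path_connection_number \<theta> l [x] e = 1"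
  by (simp add: path_connection_number_def)

text \<open>Splitting off the factor \<open>i = 1\<close> and shifting the index gives the recursive
  form that inductions along walks use.\<close>

lemma path_connection_number_Cons_Cons:
  "path_connection_number \<theta> l (x # y # ys) e =
     l (x, y) e * path_connection_number \<theta> l (y # ys) (\<theta> (x, y) e)"
proof -
  let ?w = "x # y # ys"
  let ?g = "\<lambda>i. l (?w ! (i - 1), ?w ! i) (path_connection \<theta> (take i ?w) e)"
  have "path_connection_number \<theta> l ?w e = prod ?g {1..<Suc (length (y # ys))}"
    by (simp add: path_connection_number_def)
  also have "\<dots> = ?g 1 * prod ?g {Suc 1..<Suc (length (y # ys))}"
    by (subst prod.atLeast_Suc_lessThan) auto
  also have "?g 1 = l (x, y) e"
    by (simp add: path_connection_def)
  also have "prod ?g {Suc 1..<Suc (length (y # ys))} =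
      (\<Prod>i = 1..<length (y # ys). ?g (Suc i))"
    by (rule prod.shift_bounds_Suc_ivl)
  also have "\<dots> = path_connection_number \<theta> l (y # ys) (\<theta> (x, y) e)"
    unfolding path_connection_number_def
  proof (rule prod.cong)
    fix i assume "i \<in> {1..<length (y # ys)}"
    then obtain j where "i = Suc j" by (cases i) auto
    then show "?g (Suc i) = l ((y # ys) ! (i - 1), (y # ys) ! i)
        (path_connection \<theta> (take i (y # ys)) (\<theta> (x, y) e))"
      by (simp add: path_connection_Cons_Cons)
  qed simp
  finally show ?thesis .
qed

section \<open>Compatibility coefficients of a 1-skeleton\<close>

text \<open>Pairwise independence says nothing when \<open>d = 1\<close>, so nonvanishing is a
  separate assumption; a generic covector supplies it.\<close>

locale nonvanishing_one_skeleton =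
  fixes d :: nat
    and G :: "'v pair_pre_digraph"
    and \<alpha> :: "'v \<times> 'v \<Rightarrow> real ^ 'n"
    and \<theta> :: "'v \<times> 'v \<Rightarrow> 'v \<times> 'v \<Rightarrow> 'v \<times> 'v"
    and l :: "'v \<times> 'v \<Rightarrow> 'v \<times> 'v \<Rightarrow> real"
  assumes skeleton: "one_skeleton d G \<alpha> \<theta> l"
    and nonzero: "e \<in> parcs G \<Longrightarrow> \<alpha> e \<noteq> 0"
begin

abbreviation E :: "'v \<Rightarrow> ('v \<times> 'v) set" where
  "E p \<equiv> out_arcs (with_proj G) p"

lemma regular: "regular_graph d G"
  and connection: "connection G \<theta>"
  and compatibility: "compatibility_system G \<theta> l"
  and axial: "generalized_axial_function G \<theta> l \<alpha>"
  and alpha_swap: "e \<in> parcs G \<Longrightarrow> \<alpha> (prod.swap e) = - \<alpha> e"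
  using skeleton by (auto simp: one_skeleton_def generalized_one_skeleton_def)

lemma graph: "pair_graph G"
  using regular by (simp add: regular_graph_def)

lemma arc_verts: "e \<in> parcs G \<Longrightarrow> fst e \<in> pverts G \<and> snd e \<in> pverts G"
proof -
  interpret pair_graph G by (rule graph)
  show "e \<in> parcs G \<Longrightarrow> fst e \<in> pverts G \<and> snd e \<in> pverts G"
    using arc_fst_in_verts arc_snd_in_verts by blast
qed

lemma pairwise_independent:
  assumes "e \<in> E p" "e' \<in> E p" "e \<noteq> e'"
  shows "\<alpha> e \<noteq> \<alpha> e'" "independent {\<alpha> e, \<alpha> e'}"
proof -
  have "p \<in> pverts G" using assms(1) arc_verts[of e] by auto
  then show "\<alpha> e \<noteq> \<alpha> e'" "independent {\<alpha> e, \<alpha> e'}"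
    using assms skeleton by (auto simp: one_skeleton_def)
qed

lemma swap_arc: "e \<in> parcs G \<Longrightarrow> prod.swap e \<in> parcs G"
proof -
  interpret pair_graph G by (rule graph)
  show "e \<in> parcs G \<Longrightarrow> prod.swap e \<in> parcs G"
    using pair_sym_arcs by (cases e) (auto simp: symmetric_def dest: symD)
qed

lemma finite_E: "finite (E p)"
proof -
  interpret pair_graph G by (rule graph)
  show ?thesis using pair_finite_arcs by (auto simp: out_arcs_def)
qed

lemma card_E: "p \<in> pverts G \<Longrightarrow> card (E p) = d"
  using regular by (simp add: regular_graph_def out_degree_def)

lemma theta_arc: "\<theta> e f \<in> E (snd e)" if "e \<in> parcs G" "f \<in> E (fst e)"
  using connection that unfolding connection_def bij_betw_def by blast

lemma theta_self: "e \<in> parcs G \<Longrightarrow> \<theta> e e = prod.swap e"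
  using connection unfolding connection_def by blast

lemma theta_swap_theta: "\<theta> (prod.swap e) (\<theta> e f) = f" if "e \<in> parcs G" "f \<in> E (fst e)"
  using connection that unfolding connection_def by blast

lemma l_swap: "l (prod.swap e) (\<theta> e f) * l e f = 1" if "e \<in> parcs G" "f \<in> E (fst e)"
proof -
  have "l e f > 0 \<and> l (prod.swap e) (\<theta> e f) = 1 / l e f"
    using compatibility that unfolding compatibility_system_def by blast
  then show ?thesis by simp
qed

text \<open>For \<open>f\<close> other than \<open>e\<close> existence is (gA2), for
  \<open>f = e\<close> a direct computation; uniqueness holds because \<open>\<alpha> e\<close> is
  nonzero. Covering \<open>f = e\<close> lets transport act on all edges at a vertex.\<close>

definition coeff :: "'v \<times> 'v \<Rightarrow> 'v \<times> 'v \<Rightarrow> real" where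
  "coeff e f = (THE c. \<alpha> f - l e f *\<^sub>R \<alpha> (\<theta> e f) = c *\<^sub>R \<alpha> e)"

lemma coeff_eqI:
  assumes "e \<in> parcs G" "\<alpha> f - l e f *\<^sub>R \<alpha> (\<theta> e f) = c *\<^sub>R \<alpha> e"
  shows "coeff e f = c"
  unfolding coeff_def using assms nonzero[of e] by (intro the_equality) auto

lemma coeff_self: "coeff e e = 1 + l e e" if "e \<in> parcs G"
  using that by (intro coeff_eqI) (simp_all add: theta_self alpha_swap scaleR_left_distrib)

lemma coeff:
  assumes e: "e \<in> parcs G" and f: "f \<in> E (fst e)"
  shows "\<alpha> f - l e f *\<^sub>R \<alpha> (\<theta> e f) = coeff e f *\<^sub>R \<alpha> e"
proof (cases "f = e")
  case True
  then show ?thesis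
    using e by (simp add: coeff_self theta_self alpha_swap scaleR_left_distrib)
next
  case False
  then obtain c where c: "\<alpha> f - l e f *\<^sub>R \<alpha> (\<theta> e f) = c *\<^sub>R \<alpha> e"
    using generalized_axial_functionD[OF axial e f] by blast
  then show ?thesis using coeff_eqI[OF e c] by metis
qed

text \<open>Scaling the defining relation of \<open>coeff e f\<close> by the inverse of
  \<open>l e f\<close> turns it into the relation for the reversed edge. This makes the two
  transports along an edge mutually inverse.\<close>

lemma coeff_swap:
  assumes e: "e \<in> parcs G" and f: "f \<in> E (fst e)"
  shows "coeff (prod.swap e) (\<theta> e f) = l (prod.swap e) (\<theta> e f) * coeff e f"
proof (rule coeff_eqI)
  show "prod.swap e \<in> parcs G" using e by (rule swap_arc)
  let ?m = "l (prod.swap e) (\<theta> e f)"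
  have "\<alpha> (\<theta> e f) - ?m *\<^sub>R \<alpha> f = - (?m *\<^sub>R (coeff e f *\<^sub>R \<alpha> e))"
    unfolding coeff[OF e f, symmetric] using l_swap[OF e f] by (simp add: scaleR_right_diff_distrib)
  then show "\<alpha> (\<theta> e f) - ?m *\<^sub>R \<alpha> (\<theta> (prod.swap e) (\<theta> e f)) =
      (?m * coeff e f) *\<^sub>R \<alpha> (prod.swap e)"
    using e f by (simp add: theta_swap_theta alpha_swap)
qed

section \<open>Linear transport and parallel sections\<close>

text \<open>
  The linear transport \<open>f \<mapsto> \<lambda>\<^sub>e(f) \<theta>\<^sub>e(f) - c\<^sub>e(f) \<cdot> swap e\<close> from the free space on the edges at
  \<open>i(e)\<close> to that on the edges at \<open>t(e)\<close>, acting contravariantly on vector-valued functions of edges.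
  The axial functions that lift \<open>\<alpha>\<close> are its parallel sections.
\<close>

definition pull :: "'v \<times> 'v \<Rightarrow> ('v \<times> 'v \<Rightarrow> 'b::real_vector) \<Rightarrow> 'v \<times> 'v \<Rightarrow> 'b" where
  "pull e B f = l e f *\<^sub>R B (\<theta> e f) - coeff e f *\<^sub>R B (prod.swap e)"

text \<open>Both endpoints must lie in \<open>S\<close>, so only values on edges starting in
  \<open>S\<close> matter and a section can be extended one vertex at a time.\<close>

definition parallel_on :: "'v set \<Rightarrow> ('v \<times> 'v \<Rightarrow> 'b::real_vector) \<Rightarrow> bool" where
  "parallel_on S B \<longleftrightarrow>
     (\<forall>e\<in>parcs G. fst e \<in> S \<longrightarrow> snd e \<in> S \<longrightarrow> (\<forall>f\<in>E (fst e). pull e B f = B f))"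

text \<open>Transport is contravariant: \<open>foldr\<close> applies the first arc last, carrying
  values at \<open>last w\<close> back to \<open>hd w\<close>.\<close>

abbreviation pull_walk :: "'v list \<Rightarrow> ('v \<times> 'v \<Rightarrow> 'b::real_vector) \<Rightarrow> 'v \<times> 'v \<Rightarrow> 'b" where
  "pull_walk w B \<equiv> foldr pull (vwalk_arcs w) B"

lemma parallel_onD:
  "parallel_on S B \<Longrightarrow> e \<in> parcs G \<Longrightarrow> fst e \<in> S \<Longrightarrow> snd e \<in> S \<Longrightarrow> f \<in> E (fst e) \<Longrightarrow> pull e B f = B f"
  by (simp add: parallel_on_def)

lemma parallel_on_mono: "parallel_on T B \<Longrightarrow> S \<subseteq> T \<Longrightarrow> parallel_on S B"
  by (auto simp: parallel_on_def)

lemma swap_in_E: "e \<in> parcs G \<Longrightarrow> prod.swap e \<in> E (snd e)"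
  using swap_arc by simp

lemma pull_cong:
  assumes "e \<in> parcs G" "f \<in> E (fst e)" "\<And>f. f \<in> E (snd e) \<Longrightarrow> B f = C f"
  shows "pull e B f = pull e C f"
  using assms theta_arc[OF assms(1,2)] swap_in_E[OF assms(1)] by (simp add: pull_def)

text \<open>The summand \<open>l e e\<close> of \<open>coeff e e\<close> cancels. Hence parallel
  sections change sign under edge reversal.\<close>

lemma pull_self: "e \<in> parcs G \<Longrightarrow> pull e B e = - B (prod.swap e)"
  by (simp add: pull_def theta_self coeff_self algebra_simps)

lemma pull_in_span:
  assumes "e \<in> parcs G" "f \<in> E (fst e)"
  shows "pull e B f \<in> span (B ` E (snd e))"
  unfolding pull_def using theta_arc[OF assms] swap_in_E[OF assms(1)]
  by (intro span_diff span_scale span_base) auto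

lemma pull_linear: "linear P \<Longrightarrow> pull e (\<lambda>x. P (B x)) f = P (pull e B f)"
  by (simp add: pull_def linear_diff linear_scale)

text \<open>Transport along an edge is invertible: by \<open>coeff_swap\<close> the two correction
  terms cancel, and the scalars multiply to 1.\<close>

lemma pull_swap_pull:
  assumes e: "e \<in> parcs G" and f: "f \<in> E (fst e)"
  shows "pull e (pull (prod.swap e) B) f = B f"
proof -
  have s: "prod.swap e \<in> parcs G" using e by (rule swap_arc)
  have "coeff e f = l e f * coeff (prod.swap e) (\<theta> e f)"
    using coeff_swap[OF e f] l_swap[OF e f] by (simp add: field_simps)
  then have "pull e (pull (prod.swap e) B) f =
      (l (prod.swap e) (\<theta> e f) * l e f) *\<^sub>R B f"
    using e f s pull_self[OF s, of B]
    by (simp add: pull_def[of e] pull_def[of "prod.swap e" _ "\<theta> e f"] theta_swap_theta algebra_simps)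
  then show ?thesis using l_swap[OF e f] by simp
qed

lemma alpha_parallel: "parallel_on S \<alpha>"
proof -
  have "pull e \<alpha> f = \<alpha> f" if "e \<in> parcs G" "f \<in> E (fst e)" for e f
    using coeff[OF that] alpha_swap[OF that(1)] by (simp add: pull_def algebra_simps)
  then show ?thesis by (simp add: parallel_on_def)
qed

lemma pull_walk_parallel:
  assumes "vwalk w (with_proj G)" "parallel_on (set w) B" "f \<in> E (hd w)"
  shows "pull_walk w B f = B f"
  using assms
proof (induction arbitrary: f rule: vwalk_induct)
  case (Base u)
  then show ?case by simp
next
  case (Cons u v es)
  have par: "parallel_on (set (v # es)) B"
    using Cons.prems(1) by (rule parallel_on_mono) auto
  have "pull_walk (u # v # es) B f = pull (u, v) B f"
    using Cons by (simp, intro pull_cong Cons.IH par) auto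
  then show ?case using Cons parallel_onD[of "set (u # v # es)" B "(u, v)"] by simp
qed

section \<open>Transport inside subskeleta\<close>

text \<open>Being totally geodesic only says that tangent edges stay tangent; applied to the
  reversed edge, it also shows that normal edges stay normal.\<close>

lemma subskeleton_facts:
  assumes H: "subskeleton k G \<theta> H"
  shows "pverts H \<subseteq> pverts G" "parcs H \<subseteq> parcs G" "pair_graph H"
    "\<And>e f. e \<in> parcs H \<Longrightarrow> f \<in> E (fst e) \<Longrightarrow> \<theta> e f \<in> parcs H \<longleftrightarrow> f \<in> parcs H"
    "\<And>e. e \<in> parcs H \<Longrightarrow> prod.swap e \<in> parcs H"
    "\<And>p. p \<in> pverts H \<Longrightarrow> card (E p \<inter> parcs H) = k"
proof -
  show sub: "pverts H \<subseteq> pverts G" "parcs H \<subseteq> parcs G" and H': "pair_graph H"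
    using H by (auto simp: subskeleton_def regular_graph_def subgraph_def)
  interpret H: pair_graph H by (rule H')
  show sw: "prod.swap e \<in> parcs H" if "e \<in> parcs H" for e
    using that H.pair_sym_arcs by (cases e) (auto simp: symmetric_def dest: symD)
  have geod: "\<theta> e f \<in> parcs H" if "e \<in> parcs H" "f \<in> E (fst e)" "f \<in> parcs H" for e f
    using H that unfolding subskeleton_def by blast
  show "\<theta> e f \<in> parcs H \<longleftrightarrow> f \<in> parcs H" if e: "e \<in> parcs H" and f: "f \<in> E (fst e)" for e f
  proof
    have "e \<in> parcs G" using e sub by blast
    assume "\<theta> e f \<in> parcs H"
    then have "\<theta> (prod.swap e) (\<theta> e f) \<in> parcs H"
      using theta_arc[OF \<open>e \<in> parcs G\<close> f] by (intro geod[OF sw[OF e]]) auto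
    then show "f \<in> parcs H" using theta_swap_theta \<open>e \<in> parcs G\<close> f by simp
  qed (use geod e f in blast)
  have "E p \<inter> parcs H = out_arcs (with_proj H) p" for p
    using sub by auto
  then show "card (E p \<inter> parcs H) = k" if "p \<in> pverts H" for p
    using H that by (simp add: subskeleton_def regular_graph_def out_degree_def)
qed

lemma vwalk_subskeleton:
  assumes "subskeleton k G \<theta> H" "vwalk w (with_proj H)"
  shows "vwalk w (with_proj G)"
  using assms(2) subskeleton_facts(1,2)[OF assms(1)] by (auto simp: vwalk_def)

lemma path_connection_subskeleton:
  assumes H: "subskeleton k G \<theta> H" and w: "vwalk w (with_proj H)" and f: "f \<in> E (hd w)"
  shows "path_connection \<theta> w f \<in> E (last w)"
    and "path_connection \<theta> w f \<in> parcs H \<longleftrightarrow> f \<in> parcs H"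
  using w f
proof (induction arbitrary: f rule: vwalk_induct)
  case (Base u)
  { case 1 then show ?case by (simp add: path_connection_def) }
  { case 2 then show ?case by (simp add: path_connection_def) }
next
  case (Cons u v es)
  then have uv: "(u, v) \<in> parcs H" "(u, v) \<in> parcs G"
    using subskeleton_facts(2)[OF H] by auto
  { case 1
    then have "\<theta> (u, v) f \<in> E v" using theta_arc[OF uv(2), of f] by simp
    then show ?case using Cons.IH(1) by (simp add: path_connection_Cons_Cons) }
  { case 2
    then have "\<theta> (u, v) f \<in> E v" using theta_arc[OF uv(2), of f] by simp
    then show ?case
      using Cons.IH(2)[of "\<theta> (u, v) f"] 2 subskeleton_facts(4)[OF H uv(1), of f]
      by (simp add: path_connection_Cons_Cons) }
qed

text \<open>
  Modulo the span of the edges of the subskeleton, transport is given by the path-connection and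
  its number.
\<close>

lemma pull_walk_subskeleton:
  assumes H: "subskeleton k G \<theta> H" and w: "vwalk w (with_proj H)" and f: "f \<in> E (hd w)"
  shows "pull_walk w B f - path_connection_number \<theta> l w f *\<^sub>R B (path_connection \<theta> w f)
           \<in> span (B ` (E (last w) \<inter> parcs H))"
  using w w f
proof (induction arbitrary: f rule: vwalk_induct)
  case (Base u)
  then show ?case
    by (simp add: path_connection_number_singleton path_connection_def span_zero)
next
  case (Cons u v es)
  let ?w = "v # es" and ?C = "pull_walk (v # es) B" and ?g = "\<theta> (u, v) f"
  let ?N = "path_connection_number \<theta> l (v # es)" and ?K = "path_connection \<theta> (v # es)"
  let ?V = "span (B ` (E (last ?w) \<inter> parcs H))"
  have w: "vwalk ?w (with_proj H)" using Cons.prems(1) by (rule vwalk_consE) auto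
  have uv: "(u, v) \<in> parcs H" "(u, v) \<in> parcs G"
    using subskeleton_facts(2)[OF H] Cons.hyps by auto
  have vu: "(v, u) \<in> parcs H" "(v, u) \<in> E (hd ?w)"
    using subskeleton_facts(2)[OF H] subskeleton_facts(5)[OF H uv(1)] by auto
  have g: "?g \<in> E (hd ?w)" using theta_arc[OF uv(2)] Cons.prems(2) by simp
  \<comment> \<open>The correction term of the first arc involves only the reversed edge
    \<open>(v, u)\<close>, which is tangent, so its transport stays in \<open>?V\<close>.\<close>
  have "?K (v, u) \<in> E (last ?w) \<inter> parcs H"
    using path_connection_subskeleton[OF H w vu(2)] vu(1) by blast
  then have "?N (v, u) *\<^sub>R B (?K (v, u)) \<in> ?V"
    by (intro span_scale span_base) auto
  with Cons.IH[OF w vu(2)] have "?C (v, u) \<in> ?V"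
    using span_add by fastforce
  then have "l (u, v) f *\<^sub>R (?C ?g - ?N ?g *\<^sub>R B (?K ?g)) - coeff (u, v) f *\<^sub>R ?C (v, u) \<in> ?V"
    by (intro span_diff[OF span_scale[OF Cons.IH[OF w g]]] span_scale)
  moreover have "pull_walk (u # v # es) B f = l (u, v) f *\<^sub>R ?C ?g - coeff (u, v) f *\<^sub>R ?C (v, u)"
    by (simp add: pull_def[of "(u, v)"])
  moreover have "last (u # v # es) = last ?w" by simp
  ultimately show ?case
    unfolding path_connection_number_Cons_Cons path_connection_Cons_Cons
    by (simp only: scaleR_right_diff_distrib scaleR_scaleR diff_diff_eq add.commute)
qed

text \<open>
  Comparing with \<open>\<alpha>\<close>, which is itself parallel and independent on the two edges of the face at each
  vertex, shows that the remaining error term vanishes.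
\<close>

lemma two_face_flat:
  fixes B :: "'v \<times> 'v \<Rightarrow> 'b::real_vector"
  assumes H: "subskeleton 2 G \<theta> H" and lev: "level G \<theta> l H" and hol: "trivial_normal_holonomy G \<theta> H"
    and w: "loop_in H p w" and f: "f \<in> E p"
  shows "pull_walk w B f = B f"
proof -
  have w': "vwalk w (with_proj H)" "hd w = p" "last w = p"
    using w by (auto simp: loop_in_def)
  then have p: "p \<in> pverts H" by (auto simp: vwalk_def)
  \<comment> \<open>Transporting the pair makes the errors for \<open>\<alpha>\<close> and
    \<open>B\<close> share their coefficients \<open>s\<close> and \<open>t\<close>, so killing them
    for \<open>\<alpha>\<close> kills them for \<open>B\<close>.\<close>
  let ?D = "\<lambda>x. (\<alpha> x, B x)"
  have pull_fst: "fst (foldr pull es ?D x) = foldr pull es \<alpha> x"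
    and pull_snd: "snd (foldr pull es ?D x) = foldr pull es B x" for es x
    by (induction es arbitrary: x) (simp_all add: pull_def)
  let ?v = "pull_walk w ?D f - ?D f"
  let ?V = "span (?D ` (E p \<inter> parcs H))"
  have trans: "pull_walk w ?D f - path_connection_number \<theta> l w f *\<^sub>R ?D (path_connection \<theta> w f) \<in> ?V"
    using pull_walk_subskeleton[OF H w'(1), of f ?D] f w' by simp
  have "?v \<in> ?V"
  \<comment> \<open>For tangent \<open>f\<close> every term lies in the plane; for normal
    \<open>f\<close> the two hypotheses turn the main term into \<open>?D f\<close>.\<close>
  proof (cases "f \<in> parcs H")
    case True
    have "path_connection \<theta> w f \<in> E p \<inter> parcs H"
      using path_connection_subskeleton[OF H w'(1), of f] f w' True by simp
    then have "path_connection_number \<theta> l w f *\<^sub>R ?D (path_connection \<theta> w f) \<in> ?V"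
      by (intro span_scale span_base) blast
    with trans have "pull_walk w ?D f \<in> ?V" using span_add by fastforce
    moreover have "?D f \<in> ?V" using f True by (intro span_base) blast
    ultimately show ?thesis by (rule span_diff)
  next
    case False
    then have n: "f \<in> normal_edges G H p" using f by (simp add: normal_edges_def)
    then have "path_connection \<theta> w f = f"
      using hol w by (simp add: trivial_normal_holonomy_def)
    moreover from this have "path_connection_number \<theta> l w f = 1"
      using lev w n p by (simp add: level_def)
    ultimately show ?thesis using trans by simp
  qed
  obtain a b where ab: "E p \<inter> parcs H = {a, b}" "a \<noteq> b"
    using subskeleton_facts(6)[OF H p] by (auto simp: card_2_iff)
  have "?D ` (E p \<inter> parcs H) = {?D a, ?D b}" using ab(1) by auto
  with \<open>?v \<in> ?V\<close> obtain s t where st: "?v = s *\<^sub>R ?D a + t *\<^sub>R ?D b"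
    by (auto simp: span_insert algebra_simps)
  have "pull_walk w \<alpha> f = \<alpha> f"
    using pull_walk_parallel[OF vwalk_subskeleton[OF H w'(1)] alpha_parallel] f w' by simp
  with st have lin: "s *\<^sub>R \<alpha> a + t *\<^sub>R \<alpha> b = 0"
    using pull_fst[of "vwalk_arcs w" f] by (simp add: prod_eq_iff)
  have "a \<in> E p" "b \<in> E p" using ab(1) by blast+
  note ind = pairwise_independent[OF this ab(2)]
  have "(\<Sum>v\<in>{\<alpha> a, \<alpha> b}. (if v = \<alpha> a then s else t) *\<^sub>R v) = 0"
    using lin ind(1) by auto
  note zero = independentD[OF ind(2) _ subset_refl this]
  have "s = 0 \<and> t = 0" using zero[of "\<alpha> a"] zero[of "\<alpha> b"] ind(1) by auto
  with st show ?thesis using pull_snd[of "vwalk_arcs w" f] by (simp add: prod_eq_iff)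
qed

lemma pull_walk_cong:
  assumes "vwalk w (with_proj G)" "f \<in> E (hd w)" "\<And>f. f \<in> E (last w) \<Longrightarrow> B f = C f"
  shows "pull_walk w B f = pull_walk w C f"
  using assms
proof (induction arbitrary: f rule: vwalk_induct)
  case (Base u)
  then show ?case by simp
next
  case (Cons u v es)
  have "pull (u, v) (pull_walk (v # es) B) f = pull (u, v) (pull_walk (v # es) C) f"
  proof (rule pull_cong)
    fix g assume "g \<in> E (snd (u, v))"
    then show "pull_walk (v # es) B g = pull_walk (v # es) C g"
      using Cons.IH[of g] Cons.prems(2) by simp
  qed (use Cons in auto)
  then show ?case by simp
qed

section \<open>Necessity: a total lift trivializes holonomy and numbers\<close>

text \<open>Applying \<open>P\<close> to both axioms for \<open>A\<close> gives relations for
  \<open>\<alpha>\<close>. As \<open>\<alpha> e\<close> is nonzero, these force \<open>m = 1\<close>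
  and \<open>c = coeff e f\<close>.\<close>

lemma total_lift_parallel:
  assumes A: "generalized_axial_function G \<theta> l A" and P: "linear P"
    and lift: "\<forall>e\<in>parcs G. \<alpha> e = P (A e)"
  shows "parallel_on S A"
proof -
  have "pull e A f = A f" if e: "e \<in> parcs G" and f: "f \<in> E (fst e)" for e f
  proof -
    obtain m where "A e = - (m *\<^sub>R A (prod.swap e))"
      using A e unfolding generalized_axial_function_def by blast
    moreover from this have "P (A e) = - (m *\<^sub>R P (A (prod.swap e)))"
      using P by (simp add: linear_neg linear_scale)
    then have "\<alpha> e = m *\<^sub>R \<alpha> e"
      using bspec[OF lift e] bspec[OF lift swap_arc[OF e]] alpha_swap[OF e] by simp
    then have "(1 - m) *\<^sub>R \<alpha> e = 0" by (simp add: scaleR_left_diff_distrib)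
    then have "m = 1" using nonzero[OF e] by simp
    ultimately have sw: "A (prod.swap e) = - A e" by simp
    show ?thesis
    proof (cases "f = e")
      case True
      then show ?thesis using pull_self[OF e, of A] sw by simp
    next
      case False
      then obtain c where c: "A f - l e f *\<^sub>R A (\<theta> e f) = c *\<^sub>R A e"
        using generalized_axial_functionD[OF A e f] by blast
      then have "P (A f) - l e f *\<^sub>R P (A (\<theta> e f)) = c *\<^sub>R P (A e)"
        using P by (metis linear_diff linear_scale)
      then have "coeff e f = c"
        using lift e f theta_arc[OF e f] by (intro coeff_eqI) auto
      then show ?thesis using c sw by (simp add: pull_def algebra_simps)
    qed
  qed
  then show ?thesis by (simp add: parallel_on_def)
qed

text \<open>Transport around a loop fixes \<open>A e\<close>, so \<open>A e\<close> agrees with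
  \<open>?N\<close> times \<open>A ?K\<close> modulo values on tangent edges. For normal
  \<open>e\<close>, independence leaves only \<open>?K = e\<close> and
  \<open>?N = 1\<close>.\<close>

lemma parallel_basis_imp_level_trivial:
  assumes H: "subskeleton k G \<theta> H" and A: "parallel_on UNIV A"
    and basis: "\<And>p. p \<in> pverts G \<Longrightarrow> inj_on A (E p) \<and> independent (A ` E p)"
  shows "level G \<theta> l H \<and> trivial_normal_holonomy G \<theta> H"
proof -
  have "path_connection \<theta> w e = e \<and> path_connection_number \<theta> l w e = 1"
    if w: "loop_in H p w" and e: "e \<in> normal_edges G H p" for p w e
  proof -
    have w': "vwalk w (with_proj H)" "hd w = p" "last w = p"
      using w by (auto simp: loop_in_def)
    then have p: "p \<in> pverts G" using subskeleton_facts(1)[OF H] hd_in_set[of w]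
      by (auto simp: vwalk_def)
    have e': "e \<in> E p" "e \<notin> parcs H" using e by (auto simp: normal_edges_def)
    let ?K = "path_connection \<theta> w e" and ?N = "path_connection_number \<theta> l w e"
    have K: "?K \<in> E p" using path_connection_subskeleton[OF H w'(1), of e] e' w' by simp
    have "A e - ?N *\<^sub>R A ?K \<in> span (A ` (E p \<inter> parcs H))"
      using pull_walk_subskeleton[OF H w'(1), of e A] e' w'
        pull_walk_parallel[OF vwalk_subskeleton[OF H w'(1)] parallel_on_mono[OF A]]
      by simp
    moreover have "A ` (E p \<inter> parcs H) \<subseteq> A ` (E p - {e})" using e' by blast
    ultimately have diff: "A e - ?N *\<^sub>R A ?K \<in> span (A ` (E p - {e}))"
      using span_mono by blast
    have not: "A e \<notin> span (A ` (E p - {e}))"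
    proof -
      have "A ` (E p - {e}) = A ` E p - {A e}"
        using basis[OF p] e' by (auto simp: inj_on_def)
      then show ?thesis using basis[OF p] e'(1) by (auto simp: dependent_def)
    qed
    have "?K = e"
    proof (rule ccontr)
      assume "?K \<noteq> e"
      then have "?N *\<^sub>R A ?K \<in> span (A ` (E p - {e}))"
        using K by (intro span_scale span_base) blast
      from span_add[OF diff this] not show False by simp
    qed
    moreover have "?N = 1"
    proof (rule ccontr)
      assume N: "?N \<noteq> 1"
      have "(1 / (1 - ?N)) *\<^sub>R (A e - ?N *\<^sub>R A e) \<in> span (A ` (E p - {e}))"
        using diff \<open>?K = e\<close> by (intro span_scale) simp
      moreover have "A e - ?N *\<^sub>R A e = (1 - ?N) *\<^sub>R A e"
        by (simp add: algebra_simps)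
      ultimately show False using not N by simp
    qed
    ultimately show ?thesis by simp
  qed
  then show ?thesis by (auto simp: level_def trivial_normal_holonomy_def)
qed

section \<open>Sufficiency: construction of a parallel section\<close>

text \<open>Well-founded induction along the orientation: by uniqueness of the minimum, any other
  vertex of the face has a lower neighbour in it, and \<open>S\<close> is closed under descent. Both
  directions are recorded because a loop needs one walk down to \<open>s\<close> and one back
  up.\<close>

lemma face_walks_to_minimum:
  assumes pol: "polarizing G \<alpha> \<xi>" and F: "face k G \<alpha> \<theta> \<xi> H"
    and s: "s \<in> pverts H" "\<forall>e\<in>E s \<inter> parcs H. \<xi> (\<alpha> e) > 0"
    and S: "\<And>x y. (x, y) \<in> parcs G \<Longrightarrow> \<xi> (\<alpha> (x, y)) > 0 \<Longrightarrow> y \<in> S \<Longrightarrow> x \<in> S"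
    and x: "x \<in> pverts H" "x \<in> S"
  shows "(\<exists>w. vwalk w (with_proj H) \<and> hd w = x \<and> last w = s \<and> set w \<subseteq> S) \<and>
         (\<exists>w. vwalk w (with_proj H) \<and> hd w = s \<and> last w = x \<and> set w \<subseteq> S)"
proof -
  let ?R = "{e \<in> parcs G. \<xi> (\<alpha> e) > 0}"
  have H: "subskeleton k G \<theta> H" using F by (simp add: face_def)
  interpret G: pair_graph G by (rule graph)
  have "wf ?R"
    using pol G.pair_finite_arcs by (auto simp: polarizing_def intro: finite_acyclic_wf)
  then show ?thesis using x
  proof (induction x rule: wf_induct_rule)
    case (less x)
    show ?case
    proof (cases "x = s")
      case True
      then have "vwalk [x] (with_proj H)" "set [x] \<subseteq> S" "hd [x] = x" "last [x] = x"
        using less.prems by (auto simp: vwalk_def)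
      then show ?thesis using True by blast
    next
      case False
      then obtain e where e: "e \<in> E x" "e \<in> parcs H" "\<not> \<xi> (\<alpha> e) > 0"
        using F s less.prems unfolding face_def by blast
      then obtain y where y: "e = (x, y)" by (cases e) auto
      have yx: "(y, x) \<in> parcs H" "(y, x) \<in> parcs G"
        using subskeleton_facts(5)[OF H e(2)] subskeleton_facts(2)[OF H] y by auto
      have "\<xi> (\<alpha> (y, x)) = - \<xi> (\<alpha> e)"
        using alpha_swap[of e] e y pol
        by (simp add: polarizing_def generic_covector_def linear_neg)
      moreover have "\<xi> (\<alpha> e) \<noteq> 0"
        using pol e by (simp add: polarizing_def generic_covector_def)
      ultimately have pos: "\<xi> (\<alpha> (y, x)) > 0" using e(3) by simp
      interpret H: pair_graph H by (rule subskeleton_facts(3)[OF H])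
      have yH: "y \<in> pverts H" using H.in_arcsD1 yx(1) by blast
      have yS: "y \<in> S" using S yx(2) pos less.prems(2) by blast
      obtain w v where
        w: "vwalk w (with_proj H)" "hd w = y" "last w = s" "set w \<subseteq> S" and
        v: "vwalk v (with_proj H)" "hd v = s" "last v = y" "set v \<subseteq> S"
        using less.IH[OF _ yH yS] yx(2) pos by auto
      have "w \<noteq> []" "v \<noteq> []" using w(1) v(1) by (auto simp: vwalk_def)
      have "vwalk (x # w) (with_proj H)"
        using w less.prems e y by (intro vwalk_consI) auto
      moreover have "vwalk (v @ [x]) (with_proj H)"
        using v less.prems yx(1) \<open>v \<noteq> []\<close> by (auto simp: vwalk_def vwalk_arcs_append)
      moreover have "hd (x # w) = x" "last (x # w) = s" "set (x # w) \<subseteq> S"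
        "hd (v @ [x]) = s" "last (v @ [x]) = x" "set (v @ [x]) \<subseteq> S"
        using \<open>w \<noteq> []\<close> \<open>v \<noteq> []\<close> w v less.prems by auto
      ultimately show ?thesis by blast
    qed
  qed
qed

text \<open>
  Two neighbours \<open>p\<close>, \<open>r\<close> of \<open>q\<close> span a 2-face with \<open>q\<close>; both descend inside it to its unique minimum,
  which closes up a loop around which transport is trivial.
\<close>

lemma pull_from_lower_unique:
  fixes A :: "'v \<times> 'v \<Rightarrow> 'b::real_vector"
  assumes pol: "polarizing G \<alpha> \<xi>" and enough: "enough_two_faces G \<alpha> \<theta> \<xi>"
    and flat: "\<And>H. face 2 G \<alpha> \<theta> \<xi> H \<Longrightarrow> level G \<theta> l H \<and> trivial_normal_holonomy G \<theta> H"
    and S: "\<And>x y. (x, y) \<in> parcs G \<Longrightarrow> \<xi> (\<alpha> (x, y)) > 0 \<Longrightarrow> y \<in> S \<Longrightarrow> x \<in> S"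
    and A: "parallel_on S A"
    and p: "(q, p) \<in> parcs G" "p \<in> S" and r: "(q, r) \<in> parcs G" "r \<in> S" and f: "f \<in> E q"
  shows "pull (q, p) A f = pull (q, r) A f"
proof (cases "p = r")
  case False
  have q: "q \<in> pverts G" using arc_verts[OF p(1)] by simp
  obtain H where H: "face 2 G \<alpha> \<theta> \<xi> H" "(q, p) \<in> parcs H" "(q, r) \<in> parcs H"
    using enough q p r False unfolding enough_two_faces_def
    by (metis (no_types, lifting) fst_conv in_out_arcs_conv prod.inject with_proj_simps(2,4))
  then have sub: "subskeleton 2 G \<theta> H" by (simp add: face_def)
  obtain s where s: "s \<in> pverts H" "\<forall>e\<in>E s \<inter> parcs H. \<xi> (\<alpha> e) > 0"
    using H(1) unfolding face_def by blast
  interpret H: pair_graph H by (rule subskeleton_facts(3)[OF sub])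
  have verts: "q \<in> pverts H" "p \<in> pverts H" "r \<in> pverts H"
    using H H.in_arcsD1 H.in_arcsD2 by blast+
  obtain w where w: "vwalk w (with_proj H)" "hd w = p" "last w = s" "set w \<subseteq> S"
    using face_walks_to_minimum[OF pol H(1) s, of S p] verts p S by blast
  obtain v where v: "vwalk v (with_proj H)" "hd v = s" "last v = r" "set v \<subseteq> S"
    using face_walks_to_minimum[OF pol H(1) s, of S r] verts r S by blast
  have ne: "w \<noteq> []" "v \<noteq> []" using w(1) v(1) by (auto simp: vwalk_def)
  then have join: "joinable w v" using w v by simp
  define u where "u = vwalk_join w v"
  have u: "vwalk u (with_proj H)" "hd u = p" "last u = r" "u \<noteq> []" "set u \<subseteq> S"
    using vwalk_joinI_vwalk[OF w(1) v(1) join] vwalk_join_hd[OF join] vwalk_join_last[OF join]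
      ne w v list.set_sel(2)[of v]
    by (auto simp: u_def vwalk_join_def)
  have arcs: "vwalk_arcs (q # u @ [q]) = (q, p) # vwalk_arcs u @ [(r, q)]"
    using u by (simp add: vwalk_arcs_append)
  have rq: "(r, q) \<in> parcs H" using subskeleton_facts(5)[OF sub H(3)] by simp
  have loop: "loop_in H q (q # u @ [q])"
    using u arcs verts H rq by (auto simp: loop_in_def vwalk_def)
  have uG: "vwalk u (with_proj G)" using vwalk_subskeleton[OF sub u(1)] .
  \<comment> \<open>Flatness is applied to \<open>?B\<close> itself: the last arc of the loop turns
    it back into \<open>A\<close> at \<open>r\<close>, the walk \<open>u\<close> keeps
    \<open>A\<close> by parallelism, and the first arc yields the pull from
    \<open>p\<close>.\<close>
  let ?B = "pull (q, r) A"
  have rqG: "(r, q) \<in> parcs G" using swap_arc[OF r(1)] by simp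
  have ret: "pull_walk u (pull (r, q) ?B) g = A g" if "g \<in> E p" for g
  proof -
    have "pull_walk u (pull (r, q) ?B) g = pull_walk u A g"
      using pull_swap_pull[OF rqG, of _ A] u that by (intro pull_walk_cong[OF uG]) auto
    also have "\<dots> = A g"
      using u that by (intro pull_walk_parallel[OF uG] parallel_on_mono[OF A]) auto
    finally show ?thesis .
  qed
  have "?B f = pull_walk (q # u @ [q]) ?B f"
    using two_face_flat[OF sub _ _ loop f, of ?B] flat[OF H(1)] by simp
  also have "\<dots> = pull (q, p) (pull_walk u (pull (r, q) ?B)) f"
    by (simp only: arcs) simp
  also have "\<dots> = pull (q, p) A f"
    using f p ret by (intro pull_cong) auto
  finally show ?thesis by simp
qed simp

text \<open>Induction over downward closed sets by removing a maximal vertex \<open>q\<close>.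
  Values at \<open>q\<close> are pulled from any neighbour in the remaining set;
  \<open>pull_from_lower_unique\<close> makes the choice irrelevant.\<close>

lemma exists_parallel_spanning:
  assumes pol: "polarizing G \<alpha> \<xi>" and enough: "enough_two_faces G \<alpha> \<theta> \<xi>"
    and flat: "\<And>H. face 2 G \<alpha> \<theta> \<xi> H \<Longrightarrow> level G \<theta> l H \<and> trivial_normal_holonomy G \<theta> H"
    and dim: "DIM('b::euclidean_space) = d"
    and "finite S" "S \<subseteq> pverts G"
    and "\<And>x y. (x, y) \<in> parcs G \<Longrightarrow> \<xi> (\<alpha> (x, y)) > 0 \<Longrightarrow> y \<in> S \<Longrightarrow> x \<in> S"
  shows "\<exists>A :: 'v \<times> 'v \<Rightarrow> 'b. parallel_on S A \<and> (\<forall>x\<in>S. span (A ` E x) = UNIV)"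
  using assms(5-)
proof (induction S rule: finite_psubset_induct)
  case (psubset S)
  let ?R = "{e \<in> parcs G. \<xi> (\<alpha> e) > 0}"
  note S = psubset.prems(2)
  interpret G: pair_graph G by (rule graph)
  show ?case
  proof (cases "S = {}")
    case True
    then show ?thesis by (simp add: parallel_on_def)
  next
    case False
    \<comment> \<open>The converse relation yields a maximal \<open>q\<close>, so that
      \<open>?T\<close> is again downward closed.\<close>
    have "wf (?R\<inverse>)"
      using pol G.pair_finite_arcs
      by (intro finite_acyclic_wf_converse) (auto simp: polarizing_def)
    then obtain q where q: "q \<in> S" and max: "\<And>y. (q, y) \<in> ?R \<Longrightarrow> y \<notin> S"
      using False unfolding wf_eq_minimal by (metis converse_iff ex_in_conv)
    let ?T = "S - {q}"
    have T: "x \<in> ?T" if "(x, y) \<in> parcs G" "\<xi> (\<alpha> (x, y)) > 0" "y \<in> ?T" for x y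
      using S[OF that(1,2)] max that by auto
    have "?T \<subset> S" "?T \<subseteq> pverts G" using q psubset.prems(1) by auto
    then obtain A :: "'v \<times> 'v \<Rightarrow> 'b" where
      A: "parallel_on ?T A" and span: "\<And>x. x \<in> ?T \<Longrightarrow> span (A ` E x) = UNIV"
      using psubset.IH[of ?T] T by blast
    have qG: "q \<in> pverts G" using q psubset.prems by blast
    obtain h :: "'v \<times> 'v \<Rightarrow> 'b" where h:
      "\<And>r f. (q, r) \<in> parcs G \<Longrightarrow> r \<in> ?T \<Longrightarrow> f \<in> E q \<Longrightarrow> pull (q, r) A f = h f"
      "span (h ` E q) = UNIV"
    proof (cases "\<exists>p\<in>?T. (q, p) \<in> parcs G")
      case True
      then obtain p where p: "p \<in> ?T" "(q, p) \<in> parcs G" by blast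
      \<comment> \<open>Inverse transport recovers the spanning values at \<open>p\<close> from
        those pulled to \<open>q\<close>, so the latter span as well.\<close>
      have "A ` E p \<subseteq> span (pull (q, p) A ` E q)"
      proof
        fix b assume "b \<in> A ` E p"
        then obtain g where g: "g \<in> E p" "b = A g" by blast
        then show "b \<in> span (pull (q, p) A ` E q)"
          using pull_swap_pull[of "(p, q)" g A] pull_in_span[of "(p, q)" g "pull (q, p) A"]
            swap_arc[OF p(2)] by simp
      qed
      then have "span (A ` E p) \<subseteq> span (pull (q, p) A ` E q)"
        by (intro span_minimal) auto
      then have "span (pull (q, p) A ` E q) = UNIV" using span[OF p(1)] by auto
      moreover have "pull (q, r) A f = pull (q, p) A f"
        if "(q, r) \<in> parcs G" "r \<in> ?T" "f \<in> E q" for r f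
        by (rule pull_from_lower_unique[OF pol enough flat _ A]) (use T that p in auto)
      ultimately show ?thesis using that by blast
    next
      case False
      \<comment> \<open>Without a neighbour in \<open>?T\<close> there is no constraint at
        \<open>q\<close>; any basis indexed by its \<open>d\<close> edges will do.\<close>
      obtain h :: "'v \<times> 'v \<Rightarrow> 'b" where "bij_betw h (E q) Basis"
        using finite_same_card_bij[of "E q" "Basis :: 'b set"] finite_E card_E[OF qG] dim by auto
      then have "span (h ` E q) = UNIV" by (simp add: bij_betw_def)
      then show ?thesis using that False by blast
    qed
    define A' where "A' e = (if fst e = q then h e else A e)" for e
    have "pull e A' f = A' f"
      if e: "e \<in> parcs G" "fst e \<in> S" "snd e \<in> S" and f: "f \<in> E (fst e)" for e f
    proof -
      have ne: "fst e \<noteq> snd e" using G.pair_no_loops e by blast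
      consider "fst e = q" | "snd e = q" | "fst e \<noteq> q" "snd e \<noteq> q" by blast
      then show ?thesis
      proof cases
        case 1
        have "pull e A' f = pull e A f"
          using e f ne 1 by (intro pull_cong) (auto simp: A'_def)
        also have "\<dots> = h f" using h(1)[of "snd e" f] e f ne 1 by (cases e) auto
        finally show ?thesis using f 1 by (simp add: A'_def)
      next
        case 2
        \<comment> \<open>For an edge entering \<open>q\<close>, the new values at \<open>q\<close>
          are those pulled along the reversed edge, so invertibility gives back
          \<open>A\<close>.\<close>
        have "pull e A' f = pull e (pull (prod.swap e) A) f"
          using h(1)[of "fst e"] swap_arc[OF e(1)] e f ne 2
          by (intro pull_cong) (auto simp: A'_def prod.swap_def)
        then show ?thesis using pull_swap_pull[OF e(1) f, of A] f ne 2 by (auto simp: A'_def)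
      next
        case 3
        have "pull e A' f = pull e A f"
          using e f 3 by (intro pull_cong) (auto simp: A'_def)
        then show ?thesis using parallel_onD[OF A e(1)] e f 3 by (simp add: A'_def)
      qed
    qed
    then have "parallel_on S A'" by (simp add: parallel_on_def)
    moreover have "span (A' ` E x) = UNIV" if "x \<in> S" for x
    proof (cases "x = q")
      case True
      then have "A' ` E x = h ` E x" by (auto simp: A'_def)
      then show ?thesis using h(2) True by simp
    next
      case False
      then have "A' ` E x = A ` E x" by (auto simp: A'_def)
      then show ?thesis using span that False by simp
    qed
    ultimately show ?thesis by blast
  qed
qed

section \<open>From parallel bases to total lifts\<close>

text \<open>\<open>P\<close> is fixed by matching bases at one vertex. Both \<open>\<alpha>\<close>
  and the composite of \<open>P\<close> with \<open>A\<close> are parallel, so their agreement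
  spreads over the connected graph.\<close>

lemma parallel_basis_projects:
  assumes A: "parallel_on (pverts G) A"
    and basis: "\<And>p. p \<in> pverts G \<Longrightarrow> inj_on A (E p) \<and> independent (A ` E p)"
  shows "\<exists>P. linear P \<and> (\<forall>e\<in>parcs G. \<alpha> e = P (A e))"
proof -
  have "strongly_connected (with_proj (mk_symmetric (with_proj G)))"
    using regular by (simp add: regular_graph_def Digraph_Component.connected_def)
  moreover have wf: "wf_digraph (with_proj (mk_symmetric (with_proj G)))"
    using arc_verts by (auto simp: wf_digraph_def parcs_mk_symmetric)
  ultimately obtain b where b: "b \<in> pverts G"
    and reach: "\<And>x. x \<in> pverts G \<Longrightarrow> b \<rightarrow>\<^sup>*\<^bsub>with_proj (mk_symmetric (with_proj G))\<^esub> x"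
    by (auto simp: strongly_connected_def)
  obtain P where P: "linear P" "\<forall>v\<in>A ` E b. P v = \<alpha> (inv_into (E b) A v)"
    using linear_independent_extend[OF conjunct2[OF basis[OF b]],
        of "\<lambda>v. \<alpha> (inv_into (E b) A v)"] by blast
  have at: "\<forall>f\<in>E x. \<alpha> f = P (A f)" if "x \<in> pverts G" for x
    using reach[OF that]
  proof (induction rule: wf_digraph.reachable_induct[OF wf, consumes 1, case_names base step])
    case base
    then show ?case using P(2) basis[OF b] by (simp add: inv_into_f_f)
  next
    case (step x y)
    \<comment> \<open>Contravariance asks for the arc from the new vertex \<open>y\<close> back to
      \<open>x\<close>; symmetry of \<open>G\<close> provides it.\<close>
    have yx: "(y, x) \<in> parcs G"
      using step(2) swap_arc by (auto simp: parcs_mk_symmetric)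
    show ?case
    proof
      fix f assume f: "f \<in> E y"
      have "\<alpha> f = pull (y, x) \<alpha> f"
        using parallel_onD[OF alpha_parallel[of UNIV] yx] f by simp
      also have "\<dots> = pull (y, x) (\<lambda>g. P (A g)) f"
        using step.IH yx f by (intro pull_cong) auto
      also have "\<dots> = P (pull (y, x) A f)" using P(1) by (rule pull_linear)
      also have "\<dots> = P (A f)"
        using parallel_onD[OF A yx, of f] arc_verts[OF yx] f by simp
      finally show "\<alpha> f = P (A f)" .
    qed
  qed
  have "\<alpha> e = P (A e)" if "e \<in> parcs G" for e
    using at[of "fst e"] that arc_verts[OF that] by simp
  then show ?thesis using P(1) by blast
qed

lemma parallel_imp_axial:
  assumes A: "parallel_on (pverts G) A"
  shows "generalized_axial_function G \<theta> l A"
proof -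
  have par: "pull e A f = A f" if "e \<in> parcs G" "f \<in> E (fst e)" for e f
    using parallel_onD[OF A] arc_verts that by blast
  have sw: "A e = - A (prod.swap e)" if "e \<in> parcs G" for e
    using par[OF that, of e] pull_self[OF that, of A] that by simp
  have "A f - l e f *\<^sub>R A (\<theta> e f) = coeff e f *\<^sub>R A e" if "e \<in> parcs G" "f \<in> E (fst e)" for e f
    using par[OF that] sw[OF that(1)] by (simp add: pull_def algebra_simps)
  moreover have "A e = - (1 *\<^sub>R A (prod.swap e))" if "e \<in> parcs G" for e
    using sw[OF that] by simp
  ultimately show ?thesis
    unfolding generalized_axial_function_def by (meson DiffD1 zero_less_one)
qed

end

lemma spanning_family_basis:
  fixes A :: "'a \<Rightarrow> 'b::euclidean_space"
  assumes "finite S" "card S = DIM('b)" "span (A ` S) = UNIV"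
  shows "inj_on A S \<and> independent (A ` S)"
proof -
  have "DIM('b) \<le> card (A ` S)"
    using span_card_ge_dim[of "A ` S" UNIV] assms by simp
  moreover have "card (A ` S) \<le> card S" using assms(1) by (rule card_image_le)
  ultimately have card: "card (A ` S) = DIM('b)" using assms(2) by simp
  then have "inj_on A S" using assms by (intro eq_card_imp_inj_on) auto
  moreover have "independent (A ` S)"
    using assms card by (intro card_le_dim_spanning[of _ UNIV]) auto
  ultimately show ?thesis by blast
qed

theorem theorem1:
  fixes G :: "'v pair_pre_digraph"
    and \<alpha> :: "'v \<times> 'v \<Rightarrow> real ^ 'n"
    and \<theta> :: "'v \<times> 'v \<Rightarrow> 'v \<times> 'v \<Rightarrow> 'v \<times> 'v"
    and l :: "'v \<times> 'v \<Rightarrow> 'v \<times> 'v \<Rightarrow> real"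
    and \<xi> :: "real ^ 'n \<Rightarrow> real"
  assumes "one_skeleton CARD('d::finite) G \<alpha> \<theta> l"
    and "effective G \<alpha>"
    and "reducible_wrt G \<alpha> \<theta> \<xi>"
  shows "has_total_lift TYPE('d) G \<alpha> \<theta> l \<longleftrightarrow>
         (\<forall>H. face 2 G \<alpha> \<theta> \<xi> H \<longrightarrow> level G \<theta> l H \<and> trivial_normal_holonomy G \<theta> H)"
proof -
  have pol: "polarizing G \<alpha> \<xi>" and enough: "enough_two_faces G \<alpha> \<theta> \<xi>"
    using assms(3) by (auto simp: reducible_wrt_def)
  interpret nonvanishing_one_skeleton "CARD('d)" G \<alpha> \<theta> l
  proof
    show "one_skeleton CARD('d) G \<alpha> \<theta> l" by fact
    show "\<alpha> e \<noteq> 0" if "e \<in> parcs G" for e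
    proof
      assume "\<alpha> e = 0"
      then have "\<xi> (\<alpha> e) = 0"
        using pol by (simp add: polarizing_def generic_covector_def linear_0)
      then show False using pol that by (simp add: polarizing_def generic_covector_def)
    qed
  qed
  \<comment> \<open>There are exactly \<open>d\<close> edges at \<open>p\<close>, so spanning values
    in dimension \<open>d\<close> form a basis.\<close>
  have basis: "inj_on A (E p) \<and> independent (A ` E p)"
    if "span (A ` E p) = UNIV" "p \<in> pverts G" for p and A :: "'v \<times> 'v \<Rightarrow> real ^ 'd"
    using that by (intro spanning_family_basis finite_E) (auto simp: card_E)
  show ?thesis
  proof
    assume "has_total_lift TYPE('d) G \<alpha> \<theta> l"
    then obtain A :: "'v \<times> 'v \<Rightarrow> real ^ 'd" and P :: "real ^ 'd \<Rightarrow> real ^ 'n"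
      where A: "generalized_axial_function G \<theta> l A" "effective G A"
        and P: "linear P" "\<forall>e\<in>parcs G. \<alpha> e = P (A e)"
      unfolding has_total_lift_def by blast
    have par: "parallel_on UNIV A" by (rule total_lift_parallel[OF A(1) P])
    show "\<forall>H. face 2 G \<alpha> \<theta> \<xi> H \<longrightarrow> level G \<theta> l H \<and> trivial_normal_holonomy G \<theta> H"
      using parallel_basis_imp_level_trivial[OF _ par] basis A(2)
      by (auto simp: face_def effective_def)
  next
    assume faces: "\<forall>H. face 2 G \<alpha> \<theta> \<xi> H \<longrightarrow> level G \<theta> l H \<and> trivial_normal_holonomy G \<theta> H"
    interpret G: pair_graph G by (rule graph)
    obtain A :: "'v \<times> 'v \<Rightarrow> real ^ 'd" where
      A: "parallel_on (pverts G) A" and span: "\<forall>x\<in>pverts G. span (A ` E x) = UNIV"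
      using exists_parallel_spanning[OF pol enough, where S = "pverts G" and 'b = "real ^ 'd"]
        faces G.pair_finite_verts G.in_arcsD1 by auto
    obtain P where P: "linear P" "\<forall>e\<in>parcs G. \<alpha> e = P (A e)"
      using parallel_basis_projects[OF A] basis span by blast
    \<comment> \<open>Effectiveness of \<open>\<alpha>\<close> enters here: its values at a single
      vertex span the target and lie in the range of \<open>P\<close>.\<close>
    have "surj P"
    proof -
      obtain p where p: "p \<in> pverts G"
        using regular
        by (auto simp: regular_graph_def Digraph_Component.connected_def strongly_connected_def)
      have "\<alpha> ` E p = P ` A ` E p" using P(2) by (force simp: image_image)
      then have "span (\<alpha> ` E p) = P ` span (A ` E p)" using P(1) by (simp add: linear_span_image)
      then show ?thesis using assms(2) span p by (simp add: effective_def)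
    qed
    then show "has_total_lift TYPE('d) G \<alpha> \<theta> l"
      using parallel_imp_axial[OF A] span P unfolding has_total_lift_def effective_def by blast
  qed
qed

end
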